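(* Let $\psi:\mathbb{R}^m\to\mathbb{R}^m$ be a $\mathcal{C}^1$ mapping, $g:\mathbb{R}^m\to\overline{\mathbb{R}}$ a polyhedral function, and $S(y)=\{x\in\mathbb{R}^m\mid y\in\psi(x)+\partial g(x)\}$. Let $\bar x$ be a nondegenerate solution of $0\in\psi(x)+\partial g(x)$, i.e. $-\psi(\bar x)\in\mathrm{ri}\,\partial g(\bar x)$, and let $\bar K=K_g(\bar x,-\psi(\bar x))$. Then the conditions (a) $\nabla\psi(\bar x)\bar K+\bar K^\perp=\mathbb{R}^m$; (b) $\{w\in\mathbb{R}^m\mid\nabla\psi(\bar x)^*w\in\bar K^\perp\}\cap\bar K=\{0\}$ are equivalent, and $S$ has a Lipschitz continuous single-valued localization $\sigma$ around $0$ for $\bar x$ if and only if one of them holds. In this case $\sigma$ is $\mathcal{C}^1$ in a neighborhood of $0$ and $$\nabla\sigma(y)=B\big(B^*\nabla\psi(\sigma(y))B\big)^{-1}B^*$$ for all $y$ sufficiently close to $0$, where $B\in\mathbb{R}^{m\times s}$ is a matrix whose columns form a basis of the linear subspace $\bar K$ and $s=\dim\bar K$.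
   Context: A proper function $g:\mathbb{R}^m\to\overline{\mathbb{R}}$ is polyhedral if its epigraph is a polyhedral convex set; $\partial g$ is the convex-analysis subdifferential; $\mathrm{ri}$ is relative interior; $A^*$ is the transpose. For $z$ with $g(z)$ finite, ${\rm d} g(z)(w)=\liminf_{t\searrow 0,\,w'\to w}\frac{g(z+tw')-g(z)}{t}$ and for $\lambda\in\partial g(z)$ the critical cone is $K_g(z,\lambda)=\{w\mid\langle\lambda,w\rangle={\rm d} g(z)(w)\}$ (under the nondegeneracy assumption $\bar K$ is a linear subspace). A Lipschitz continuous single-valued localization of $S$ around $0$ for $\bar x$ means there are neighborhoods $U$ of $\bar x$ and $V$ of $0$ such that $\sigma(y):=S(y)\cap U$ is single-valued and Lipschitz continuous on $V$. *)

theory Defs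
  imports "HOL-Analysis.Analysis" "HOL-Library.Extended_Real"
begin

definition epigraph :: "('a \<Rightarrow> ereal) \<Rightarrow> ('a \<times> real) set" where
  "epigraph g = {(x, t). g x \<le> ereal t}"

definition proper_fun :: "('a \<Rightarrow> ereal) \<Rightarrow> bool" where
  "proper_fun g \<longleftrightarrow> (\<forall>x. g x \<noteq> -\<infinity>) \<and> (\<exists>x. g x \<noteq> \<infinity>)"

definition polyhedral_fun :: "('a::euclidean_space \<Rightarrow> ereal) \<Rightarrow> bool" where
  "polyhedral_fun g \<longleftrightarrow> proper_fun g \<and> polyhedron (epigraph g) \<and> convex (epigraph g)"

definition subdiff :: "('a::real_inner \<Rightarrow> ereal) \<Rightarrow> 'a \<Rightarrow> 'a set" where
  "subdiff g x = {v. \<bar>g x\<bar> \<noteq> \<infinity> \<and> (\<forall>z. g x + ereal (v \<bullet> (z - x)) \<le> g z)}"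

definition subderiv :: "('a::real_normed_vector \<Rightarrow> ereal) \<Rightarrow> 'a \<Rightarrow> 'a \<Rightarrow> ereal" where
  "subderiv g z w = Liminf (at_right (0::real) \<times>\<^sub>F nhds w)
      (\<lambda>(t, w'). (g (z + t *\<^sub>R w') - g z) / ereal t)"

definition crit_cone :: "('a::real_inner \<Rightarrow> ereal) \<Rightarrow> 'a \<Rightarrow> 'a \<Rightarrow> 'a set" where
  "crit_cone g z lam = {w. ereal (lam \<bullet> w) = subderiv g z w}"

definition sol_map :: "('a::real_inner \<Rightarrow> 'a) \<Rightarrow> ('a \<Rightarrow> ereal) \<Rightarrow> 'a \<Rightarrow> 'a set" where
  "sol_map \<psi> g y = {x. \<exists>v \<in> subdiff g x. y = \<psi> x + v}"

definition lip_localization ::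
  "('b::metric_space \<Rightarrow> 'a::metric_space set) \<Rightarrow> 'b \<Rightarrow> 'a \<Rightarrow> ('b \<Rightarrow> 'a) \<Rightarrow> 'a set \<Rightarrow> 'b set \<Rightarrow> bool" where
  "lip_localization S y0 x0 \<sigma> U V \<longleftrightarrow>
     (\<forall>\<^sub>F x in nhds x0. x \<in> U) \<and> (\<forall>\<^sub>F y in nhds y0. y \<in> V) \<and> (\<forall>y\<in>V. S y \<inter> U = {\<sigma> y}) \<and> (\<exists>C. lipschitz_on C V \<sigma>)"

end

theory Submission
  imports Defs
begin

text \<open>Near \<open>(xbar, lam)\<close> with \<open>lam = - \<psi> xbar\<close>, the graph of the subdifferential of \<open>g\<close> coincides with
  \<open>(xbar, lam) + K \<times> K\<^sup>\<bottom>\<close>: the epigraph agrees locally with its tangent cone, so \<open>g\<close> is affine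
  along short segments from \<open>xbar\<close>, and nondegeneracy makes the normal cones to \<open>\<partial>g(xbar)\<close> at
  points near \<open>lam\<close> all equal to the subspace \<open>K\<close>. With the orthogonal projection \<open>P\<close> onto \<open>K\<close>, the
  inclusion \<open>y \<in> \<psi> x + \<partial>g x\<close> therefore reads locally as the smooth equation
  \<open>P (\<psi> x - \<psi> xbar) + (I - P) (x - xbar) = P y\<close>, whose Jacobian \<open>P J + I - P\<close> is invertible
  exactly under (a) or (b), and the inverse function theorem applies.\<close>

subsection \<open>Local structure of polyhedral functions\<close>

text \<open>Only the half-spaces that are active at \<open>(x, c)\<close> shape \<open>T\<close>.
  The inactive ones have positive slack, which a small enough step cannot use up. The restriction on
  \<open>r\<close> is one-sided because an epigraph is closed upwards.\<close>

lemma epigraph_tangent_cone: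
  fixes g :: "'a::euclidean_space \<Rightarrow> ereal"
  assumes poly: "polyhedral_fun g" and gx: "g x = ereal c"
  obtains T e where "closed T" "convex T" "\<And>s d. d \<in> T \<Longrightarrow> 0 \<le> s \<Longrightarrow> s *\<^sub>R d \<in> T"
    "\<And>w r. g (x + w) \<le> ereal (c + r) \<Longrightarrow> (w, r) \<in> T" "0 < e"
    "\<And>w r. (w, r) \<in> T \<Longrightarrow> norm w < e \<Longrightarrow> - e < r \<Longrightarrow> g (x + w) \<le> ereal (c + r)"
proof -
  obtain F where F: "finite F" "epigraph g = \<Inter>F"
    and FF: "\<forall>h\<in>F. \<exists>a b. a \<noteq> 0 \<and> h = {z. a \<bullet> z \<le> b}"
    using poly unfolding polyhedral_fun_def polyhedron_def by metis
  obtain a b where ab: "\<And>h. h \<in> F \<Longrightarrow> h = {z. a h \<bullet> z \<le> b h}"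
    using FF by metis
  have epi: "g z \<le> ereal t \<longleftrightarrow> (\<forall>h\<in>F. a h \<bullet> (z, t) \<le> b h)" for z t
  proof -
    have "g z \<le> ereal t \<longleftrightarrow> (z, t) \<in> \<Inter>F"
      using F(2) by (auto simp: epigraph_def)
    also have "\<dots> \<longleftrightarrow> (\<forall>h\<in>F. a h \<bullet> (z, t) \<le> b h)"
      using ab by blast
    finally show ?thesis .
  qed
  define slack where "slack h = b h - a h \<bullet> (x, c)" for h
  have slack0: "slack h \<ge> 0" if "h \<in> F" for h
    using epi[of x c] that by (auto simp: slack_def gx)
  \<comment> \<open>The vertical ray above \<open>(x, c)\<close> stays in the epigraph, so no
    constraint can bound the last coordinate from above. The witness \<open>t\<close> overshoots the
    slack by exactly \<open>snd (a h)\<close>.\<close>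
  have down: "snd (a h) \<le> 0" if "h \<in> F" for h
  proof (rule ccontr)
    assume "\<not> snd (a h) \<le> 0"
    then have pos: "snd (a h) > 0" by simp
    define t where "t = slack h / snd (a h) + 1"
    have "t \<ge> 0" using pos slack0[OF that] by (simp add: t_def)
    then have "a h \<bullet> (x, c + t) \<le> b h"
      using epi[of x "c + t"] that by (simp add: gx)
    then have "snd (a h) * t \<le> slack h"
      by (cases "a h") (simp add: slack_def algebra_simps)
    moreover have "snd (a h) * t = slack h + snd (a h)"
      using pos by (simp add: t_def field_simps)
    ultimately show False using pos by simp
  qed
  define A where "A = {h \<in> F. slack h = 0}"
  define T where "T = (\<Inter>h\<in>A. {d. a h \<bullet> d \<le> 0})"
  \<comment> \<open>A step whose two components contribute at most
    \<open>norm (fst (a h)) * m h\<close> and \<open>\<bar>snd (a h)\<bar> * m h\<close> consumes at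
    most the slack of \<open>h\<close>. The summand 1 keeps the denominator positive, and the 1
    inserted into \<open>e\<close> covers the case where every constraint is active.\<close>
  define m where "m h = slack h / (norm (fst (a h)) + \<bar>snd (a h)\<bar> + 1)" for h
  define e where "e = Min (insert 1 (m ` (F - A)))"
  have m_pos: "m h > 0" if "h \<in> F - A" for h
  proof -
    have "slack h > 0" using slack0[of h] that by (auto simp: A_def less_le)
    then show ?thesis by (auto simp: m_def intro!: divide_pos_pos add_nonneg_pos)
  qed
  have e_pos: "e > 0" using F(1) m_pos by (auto simp: e_def)
  have e_le: "e \<le> m h" if "h \<in> F - A" for h
    using F(1) that by (auto simp: e_def)
  have shift: "a h \<bullet> (x + w, c + r) = a h \<bullet> (x, c) + a h \<bullet> (w, r)" for h w r
    by (cases "a h") (simp add: algebra_simps)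
  show thesis
  proof (rule that[of T e])
    show "closed T" unfolding T_def by (intro closed_INT ballI closed_halfspace_le)
    show "convex T" unfolding T_def by (intro convex_INT convex_halfspace_le)
    show "s *\<^sub>R d \<in> T" if "d \<in> T" "0 \<le> s" for s d
      using that by (auto simp: T_def mult_nonneg_nonpos)
    show "(w, r) \<in> T" if "g (x + w) \<le> ereal (c + r)" for w r
      using that unfolding epi shift by (force simp: T_def A_def slack_def)
    show "0 < e" by (rule e_pos)
    fix w r assume T: "(w, r) \<in> T" and w: "norm w < e" and r: "- e < r"
    show "g (x + w) \<le> ereal (c + r)"
      unfolding epi
    proof
      fix h assume h: "h \<in> F"
      show "a h \<bullet> (x + w, c + r) \<le> b h"
      proof (cases "h \<in> A")
        case True
        then show ?thesis using T unfolding shift by (auto simp: T_def A_def slack_def)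
      next
        case False
        have "fst (a h) \<bullet> w \<le> norm (fst (a h)) * norm w" by (rule norm_cauchy_schwarz)
        also have "\<dots> \<le> norm (fst (a h)) * e" using w by (intro mult_left_mono) auto
        finally have 1: "fst (a h) \<bullet> w \<le> norm (fst (a h)) * e" .
        have "(- snd (a h)) * (- r) \<le> (- snd (a h)) * e"
          using r down[OF h] by (intro mult_left_mono) auto
        then have "snd (a h) * r \<le> \<bar>snd (a h)\<bar> * e" using down[OF h] by simp
        with 1 have "a h \<bullet> (w, r) \<le> (norm (fst (a h)) + \<bar>snd (a h)\<bar> + 1) * e"
          using e_pos by (cases "a h") (simp add: algebra_simps)
        also have "\<dots> \<le> slack h"
          using e_le[of h] h False
          by (simp add: m_def pos_le_divide_eq mult.commute add_nonneg_pos)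
        finally show ?thesis unfolding shift by (simp add: slack_def)
      qed
    qed
  qed
qed

lemma obtain_small_scaling:
  fixes u :: "'a::real_normed_vector"
  assumes "0 < (d::real)"
  obtains s where "0 < s" "norm (s *\<^sub>R u) < d"
proof
  let ?s = "d / (2 * (norm u + 1))"
  have pos: "2 * (norm u + 1) > 0" by (intro mult_pos_pos add_nonneg_pos) auto
  show s: "0 < ?s" using assms pos by (rule divide_pos_pos)
  have "?s * norm u < ?s * (2 * (norm u + 1))"
    using s by (rule mult_strict_left_mono[rotated]) (simp add: add_nonneg_pos)
  also have "\<dots> = d" using pos by simp
  finally show "norm (?s *\<^sub>R u) < d" using s assms by simp
qed

text \<open>Where the subgradient inequality at \<open>x\<close> is tight, its affine minorant
  touches \<open>g\<close> again, so the same slope supports \<open>g\<close> there.\<close>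

lemma subdiff_segment:
  assumes "v \<in> subdiff g x" "g x = ereal c" "g (x + w) = ereal (c + v \<bullet> w)"
  shows "v \<in> subdiff g (x + w)"
proof -
  have "ereal (c + v \<bullet> w) + ereal (v \<bullet> (z - (x + w))) \<le> g z" for z
  proof -
    have "ereal (c + v \<bullet> w) + ereal (v \<bullet> (z - (x + w))) = ereal c + ereal (v \<bullet> (z - x))"
      by (simp add: inner_diff_right inner_add_right)
    also have "\<dots> \<le> g z" using assms(1,2) by (auto simp: subdiff_def)
    finally show ?thesis .
  qed
  then show ?thesis by (auto simp: subdiff_def assms(3))
qed

section \<open>Critical cone and subdifferential graph at a nondegenerate point\<close>

context
  fixes g :: "'a::euclidean_space \<Rightarrow> ereal" and x lam :: 'a
  assumes poly: "polyhedral_fun g" and ri: "lam \<in> rel_interior (subdiff g x)"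
begin

lemma rel_interior_subdiff_imp_subdiff: "lam \<in> subdiff g x"
  using ri rel_interior_subset by blast

text \<open>A linear function with its maximum over a convex set at a relative interior point is
  constant on the set: a short step from \<open>v0\<close> away from \<open>v\<close> remains in the
  set, and a strictly smaller value at \<open>v\<close> would give a larger value there. The point
  \<open>v0\<close> is kept general because the fact is applied both to \<open>lam\<close> and to
  subgradients near it.\<close>

lemma inner_const_on_subdiff:
  assumes v0: "v0 \<in> subdiff g x"
    and le: "\<And>v. v \<in> subdiff g x \<Longrightarrow> v \<bullet> w \<le> v0 \<bullet> w"
    and v0ri: "v0 \<in> rel_interior (subdiff g x)"
    and v: "v \<in> subdiff g x"
  shows "(v - v0) \<bullet> w = 0"
proof -
  obtain d where d: "d > 0" "ball v0 d \<inter> affine hull subdiff g x \<subseteq> subdiff g x"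
    using v0ri mem_rel_interior_ball by blast
  obtain s where s: "s > 0" "norm (s *\<^sub>R (v - v0)) < d"
    using obtain_small_scaling[OF d(1)] .
  then have "v0 - s *\<^sub>R (v - v0) \<in> ball v0 d" by (simp add: dist_norm)
  moreover have "v0 - s *\<^sub>R (v - v0) \<in> affine hull subdiff g x"
  proof -
    have "(1 + s) *\<^sub>R v0 + (- s) *\<^sub>R v \<in> affine hull subdiff g x"
      using v v0 by (intro mem_affine[OF affine_affine_hull]) (auto simp: hull_inc)
    then show ?thesis by (simp add: algebra_simps)
  qed
  ultimately have "v0 - s *\<^sub>R (v - v0) \<in> subdiff g x" using d by blast
  then have "s * ((v - v0) \<bullet> w) \<ge> 0" using le by (fastforce simp: inner_diff_left)
  then have "(v - v0) \<bullet> w \<ge> 0" using s by (simp add: zero_le_mult_iff)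
  moreover have "(v - v0) \<bullet> w \<le> 0" using le[OF v] by (simp add: inner_diff_left)
  ultimately show ?thesis by simp
qed

text \<open>All facts come from the tangent cone \<open>T\<close> of the epigraph: \<open>w\<close>
  is critical iff \<open>(w, lam \<bullet> w)\<close> lies in \<open>T\<close>, iff all subgradients
  agree on \<open>w\<close>. The doubling estimate reflects that \<open>T\<close> is a cone; it
  later plays the part of a reflection of \<open>x\<close> through \<open>x + w\<close>.\<close>

lemma subdiff_critical_data:
  obtains c e where "g x = ereal c" "0 < e"
    "\<And>w. w \<in> crit_cone g x lam \<longleftrightarrow> (\<forall>v\<in>subdiff g x. (v - lam) \<bullet> w = 0)"
    "\<And>w. w \<in> crit_cone g x lam \<Longrightarrow> norm w < e \<Longrightarrow> g (x + w) = ereal (c + lam \<bullet> w)"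
    "\<And>w r. norm w < e \<Longrightarrow> g (x + w) = ereal (c + r) \<Longrightarrow> g (x + 2 *\<^sub>R w) \<le> ereal (c + 2 * r)"
proof -
  have lam: "lam \<in> subdiff g x" by (rule rel_interior_subdiff_imp_subdiff)
  then obtain c where c: "g x = ereal c" by (cases "g x") (auto simp: subdiff_def)
  have sub: "g (x + w) \<ge> ereal (c + v \<bullet> w)" if "v \<in> subdiff g x" for v w
  proof -
    have "g x + ereal (v \<bullet> (x + w - x)) \<le> g (x + w)"
      using that unfolding subdiff_def by blast
    then show ?thesis by (simp add: c)
  qed
  \<comment> \<open>Testing on epigraph points avoids infinite values; it suits the subgradients
    built below from separating functionals.\<close>
  have mem_sub: "v \<in> subdiff g x" if "\<And>w r. g (x + w) \<le> ereal (c + r) \<Longrightarrow> v \<bullet> w \<le> r" for v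
  proof -
    have "ereal c + ereal (v \<bullet> (z - x)) \<le> g z" for z
    proof (cases "g z")
      case (real r)
      have "v \<bullet> (z - x) \<le> r - c" by (rule that) (simp add: real)
      then show ?thesis by (simp add: real)
    next
      case MInf
      then show ?thesis using poly by (auto simp: polyhedral_fun_def proper_fun_def)
    qed auto
    then show ?thesis by (auto simp: subdiff_def c)
  qed
  obtain T e where T: "closed T" "convex T" "\<And>s d. d \<in> T \<Longrightarrow> 0 \<le> s \<Longrightarrow> s *\<^sub>R d \<in> T"
    and T1: "\<And>w r. g (x + w) \<le> ereal (c + r) \<Longrightarrow> (w, r) \<in> T" and e: "0 < e"
    and T2: "\<And>w r. (w, r) \<in> T \<Longrightarrow> norm w < e \<Longrightarrow> - e < r \<Longrightarrow> g (x + w) \<le> ereal (c + r)"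
    using epigraph_tangent_cone[OF poly c] by blast
  \<comment> \<open>This radius makes \<open>2 *\<^sub>R w\<close> shorter than \<open>e\<close> and
    keeps \<open>2 * (lam \<bullet> w)\<close> above \<open>- e\<close>, the two bounds needed to
    return from \<open>T\<close> to the epigraph even after doubling.\<close>
  define e' where "e' = e / (2 * norm lam + 2)"
  have e': "e' > 0" using e by (auto simp: e'_def intro!: divide_pos_pos add_nonneg_pos)
  have e'le: "2 * e' \<le> e"
  proof -
    have "2 * e \<le> (2 * norm lam + 2) * e" using e by (intro mult_right_mono) auto
    then show ?thesis
      using add_nonneg_pos[of "2 * norm lam" 2] by (simp add: e'_def pos_divide_le_eq mult.commute)
  qed
  have small: "2 * (lam \<bullet> w) > - e" if "norm w < e'" for w
  proof -
    have "\<bar>lam \<bullet> w\<bar> \<le> norm lam * norm w" by (rule Cauchy_Schwarz_ineq2)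
    also have "\<dots> \<le> norm lam * e'" using that by (intro mult_left_mono) auto
    finally have "2 * \<bar>lam \<bullet> w\<bar> \<le> 2 * norm lam * e'" by simp
    also have "\<dots> < (2 * norm lam + 2) * e'" using e' by (simp add: algebra_simps)
    also have "\<dots> = e"
      using add_nonneg_pos[of "2 * norm lam" 2] by (simp add: e'_def)
    finally show ?thesis by linarith
  qed
  have local_eq: "g (x + w) = ereal (c + lam \<bullet> w)" if "(w, lam \<bullet> w) \<in> T" "norm w < e'" for w
  proof (rule antisym)
    show "g (x + w) \<le> ereal (c + lam \<bullet> w)"
      using that e'le e' small[of w] e by (intro T2) auto
    show "ereal (c + lam \<bullet> w) \<le> g (x + w)" by (rule sub[OF lam])
  qed
  have lower: "ereal (lam \<bullet> w) \<le> subderiv g x w" for w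
    unfolding subderiv_def le_Liminf_iff
  proof (intro allI impI)
    fix y assume y: "y < ereal (lam \<bullet> w)"
    have "((\<lambda>w'. ereal (lam \<bullet> w')) \<longlongrightarrow> ereal (lam \<bullet> w)) (nhds w)"
      by (intro tendsto_intros filterlim_ident)
    then have "\<forall>\<^sub>F w' in nhds w. y < ereal (lam \<bullet> w')"
      using y by (rule order_tendstoD)
    moreover have "\<forall>\<^sub>F t in at_right (0::real). 0 < t" by (simp add: eventually_at_right_less)
    ultimately have "\<forall>\<^sub>F p in at_right (0::real) \<times>\<^sub>F nhds w. 0 < fst p \<and> y < ereal (lam \<bullet> snd p)"
      by (auto simp: eventually_prod_filter intro!: exI[of _ "\<lambda>t. 0 < t"] exI[of _ "\<lambda>w'. y < ereal (lam \<bullet> w')"])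
    then show "\<forall>\<^sub>F p in at_right 0 \<times>\<^sub>F nhds w. y < (case p of (t, w') \<Rightarrow> (g (x + t *\<^sub>R w') - g x) / ereal t)"
    proof eventually_elim
      case (elim p)
      obtain t w' where p: "p = (t, w')" by force
      with elim have t: "t > 0" and y: "y < ereal (lam \<bullet> w')" by auto
      have "ereal (lam \<bullet> w') \<le> (g (x + t *\<^sub>R w') - g x) / ereal t"
        using sub[OF lam, of "t *\<^sub>R w'"] t
        by (cases "g (x + t *\<^sub>R w')") (auto simp: c field_simps)
      with y show ?case by (simp add: p)
    qed
  qed
  have K1: "w \<in> crit_cone g x lam \<longleftrightarrow> (w, lam \<bullet> w) \<in> T" for w
  proof
    assume "w \<in> crit_cone g x lam"
    then have eq: "subderiv g x w = ereal (lam \<bullet> w)" by (simp add: crit_cone_def)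
    show "(w, lam \<bullet> w) \<in> T"
    proof (rule ccontr)
      assume "(w, lam \<bullet> w) \<notin> T"
      \<comment> \<open>As \<open>T\<close> is closed, a whole box around the point misses it. A
        difference quotient below \<open>lam \<bullet> w + d / 2\<close> in a direction from
        \<open>A\<close> would, after rescaling by \<open>1 / t\<close>, produce a point of
        \<open>T\<close> in this box.\<close>
      then obtain A B where AB: "open A" "open B" "w \<in> A" "lam \<bullet> w \<in> B" "A \<times> B \<subseteq> - T"
        using T(1) open_prod_elim[of "- T" "(w, lam \<bullet> w)"]
        unfolding mem_Times_iff fst_conv snd_conv by (metis ComplI open_Compl)
      obtain d where d: "d > 0" "ball (lam \<bullet> w) d \<subseteq> B" using AB open_contains_ball by blast
      have B: "lam \<bullet> w + d / 2 \<in> B" using d by (auto simp: subset_iff dist_norm)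
      have "\<forall>\<^sub>F w' in nhds w. w' \<in> A" using AB by (simp add: eventually_nhds_in_open)
      moreover have "\<forall>\<^sub>F t in at_right (0::real). 0 < t" by (simp add: eventually_at_right_less)
      ultimately have "\<forall>\<^sub>F p in at_right (0::real) \<times>\<^sub>F nhds w. 0 < fst p \<and> snd p \<in> A"
        by (auto simp: eventually_prod_filter intro!: exI[of _ "\<lambda>t. 0 < t"] exI[of _ "\<lambda>w'. w' \<in> A"])
      then have "\<forall>\<^sub>F p in at_right (0::real) \<times>\<^sub>F nhds w.
          ereal (lam \<bullet> w + d / 2) \<le> (case p of (t, w') \<Rightarrow> (g (x + t *\<^sub>R w') - g x) / ereal t)"
      proof eventually_elim
        case (elim p)
        obtain t w' where p: "p = (t, w')" by force
        with elim have t: "t > 0" and w': "w' \<in> A" by auto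
        show ?case
        proof (rule ccontr)
          assume "\<not> ?thesis"
          then have "(g (x + t *\<^sub>R w') - g x) / ereal t < ereal (lam \<bullet> w + d / 2)"
            by (simp add: p)
          then have "g (x + t *\<^sub>R w') \<le> ereal (c + t * (lam \<bullet> w + d / 2))"
            using t by (cases "g (x + t *\<^sub>R w')") (auto simp: c field_simps)
          then have "(t *\<^sub>R w', t * (lam \<bullet> w + d / 2)) \<in> T" by (rule T1)
          from T(3)[OF this, of "1 / t"] have "(w', lam \<bullet> w + d / 2) \<in> T" using t by simp
          then show False using AB(5) w' B by blast
        qed
      qed
      then have "ereal (lam \<bullet> w + d / 2) \<le> subderiv g x w"
        unfolding subderiv_def by (rule Liminf_bounded)
      then show False using eq d by simp
    qed
  next
    assume wT: "(w, lam \<bullet> w) \<in> T"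
    \<comment> \<open>The constant direction \<open>w' = w\<close> is admissible in the lower limit,
      and for small \<open>t\<close> its quotient is exactly \<open>lam \<bullet> w\<close> by
      \<open>local_eq\<close>.\<close>
    have "subderiv g x w \<le> ereal (lam \<bullet> w)"
    proof (rule ccontr)
      assume "\<not> ?thesis"
      then have "\<forall>\<^sub>F p in at_right (0::real) \<times>\<^sub>F nhds w.
          ereal (lam \<bullet> w) < (case p of (t, w') \<Rightarrow> (g (x + t *\<^sub>R w') - g x) / ereal t)"
        unfolding subderiv_def by (intro less_LiminfD) simp
      then obtain P Q where P: "eventually P (at_right (0::real))" and Q: "eventually Q (nhds w)"
        and PQ: "\<And>t w'. P t \<Longrightarrow> Q w' \<Longrightarrow> ereal (lam \<bullet> w) < (g (x + t *\<^sub>R w') - g x) / ereal t"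
        unfolding eventually_prod_filter by fastforce
      have "Q w" using Q by (rule eventually_nhds_x_imp_x)
      have "((\<lambda>t. norm (t *\<^sub>R w)) \<longlongrightarrow> norm (0 *\<^sub>R w)) (at_right 0)"
        by (intro tendsto_intros)
      then have "\<forall>\<^sub>F t in at_right 0. norm (t *\<^sub>R w) < e'"
        using e' by (intro order_tendstoD) auto
      with P eventually_at_right_less[of 0]
      have "\<forall>\<^sub>F t in at_right 0. P t \<and> 0 < t \<and> norm (t *\<^sub>R w) < e'"
        by eventually_elim auto
      then obtain t where t: "P t" "0 < t" "norm (t *\<^sub>R w) < e'"
        using eventually_happens trivial_limit_at_right_real by blast
      have "(t *\<^sub>R w, lam \<bullet> (t *\<^sub>R w)) \<in> T" using T(3)[OF wT, of t] t by simp
      then have "g (x + t *\<^sub>R w) = ereal (c + lam \<bullet> (t *\<^sub>R w))" using t by (intro local_eq)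
      then show False using PQ[OF t(1) \<open>Q w\<close>] t by (simp add: c)
    qed
    with lower[of w] show "w \<in> crit_cone g x lam" by (simp add: crit_cone_def)
  qed
  have K2: "(w, lam \<bullet> w) \<in> T \<longleftrightarrow> (\<forall>v\<in>subdiff g x. (v - lam) \<bullet> w = 0)" for w
  proof
    assume wT: "(w, lam \<bullet> w) \<in> T"
    obtain t where t: "t > 0" and tw: "norm (t *\<^sub>R w) < e'"
      using obtain_small_scaling[OF e'] .
    have "(t *\<^sub>R w, lam \<bullet> (t *\<^sub>R w)) \<in> T" using T(3)[OF wT, of t] t by simp
    then have eq: "g (x + t *\<^sub>R w) = ereal (c + lam \<bullet> (t *\<^sub>R w))" using tw by (intro local_eq)
    \<comment> \<open>Tightness of \<open>lam\<close> along \<open>w\<close> makes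
      \<open>lam\<close> a maximizer of \<open>v \<bullet> w\<close> over the subdifferential, and
      \<open>lam\<close> is a relative interior point.\<close>
    have "v \<bullet> w \<le> lam \<bullet> w" if "v \<in> subdiff g x" for v
      using sub[OF that, of "t *\<^sub>R w"] t by (simp add: eq)
    then show "\<forall>v\<in>subdiff g x. (v - lam) \<bullet> w = 0"
      using inner_const_on_subdiff[OF lam _ ri] by blast
  next
    assume w: "\<forall>v\<in>subdiff g x. (v - lam) \<bullet> w = 0"
    show "(w, lam \<bullet> w) \<in> T"
    proof (rule ccontr)
      assume "(w, lam \<bullet> w) \<notin> T"
      then obtain a b where ab: "a \<bullet> (w, lam \<bullet> w) < b" "\<And>d. d \<in> T \<Longrightarrow> a \<bullet> d > b"
        using separating_hyperplane_closed_point[OF T(2,1)] by metis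
      have zT: "(0, 0) \<in> T" using T1[of 0 0] by (simp add: c)
      then have b0: "b < 0" using ab(2)[OF zT] by (simp add: zero_prod_def[symmetric])
      \<comment> \<open>On a cone a functional bounded below is nonnegative: otherwise rescaling
        \<open>d\<close> would attain the excluded value \<open>b\<close>.\<close>
      have pos: "a \<bullet> d \<ge> 0" if "d \<in> T" for d
      proof (rule ccontr)
        assume "\<not> a \<bullet> d \<ge> 0"
        then have n: "a \<bullet> d < 0" by simp
        have "(b / (a \<bullet> d)) *\<^sub>R d \<in> T" using T(3)[OF that] n b0 by (simp add: divide_nonpos_nonpos)
        then show False using ab(2)[of "(b / (a \<bullet> d)) *\<^sub>R d"] n by simp
      qed
      obtain u s where a: "a = (u, s)" by force
      have pos': "u \<bullet> w' + s * r \<ge> 0" if "g (x + w') \<le> ereal (c + r)" for w' r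
        using pos[OF T1[OF that]] by (simp add: a)
      have neg: "u \<bullet> w + s * (lam \<bullet> w) < 0" using ab(1) b0 by (simp add: a)
      have s0: "s \<ge> 0" using pos'[of 0 1] by (simp add: c)
      \<comment> \<open>Either kind of separating functional yields a subgradient that differs from
        \<open>lam\<close> on \<open>w\<close>. For \<open>s > 0\<close> it is the slope
        \<open>- (1 / s) *\<^sub>R u\<close>; for \<open>s = 0\<close> the hyperplane is vertical
        and \<open>- u\<close> is a direction in which \<open>lam\<close> can be moved within the
        subdifferential.\<close>
      show False
      proof (cases "s = 0")
        case True
        have "lam - u \<in> subdiff g x"
        proof (rule mem_sub)
          fix w' r assume *: "g (x + w') \<le> ereal (c + r)"
          have "ereal (c + lam \<bullet> w') \<le> ereal (c + r)"
            using sub[OF lam, of w'] * by (rule order_trans)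
          with pos'[OF *] show "(lam - u) \<bullet> w' \<le> r" by (simp add: True inner_diff_left)
        qed
        then have "(lam - u - lam) \<bullet> w = 0" using w by blast
        then show False using neg True by (simp add: inner_diff_left)
      next
        case False
        with s0 have s: "s > 0" by simp
        have "- (1 / s) *\<^sub>R u \<in> subdiff g x"
        proof (rule mem_sub)
          fix w' r assume *: "g (x + w') \<le> ereal (c + r)"
          show "(- (1 / s) *\<^sub>R u) \<bullet> w' \<le> r" using pos'[OF *] s by (simp add: field_simps)
        qed
        then have "(- (1 / s) *\<^sub>R u - lam) \<bullet> w = 0" using w by blast
        then show False using neg s by (simp add: inner_diff_left field_simps)
      qed
    qed
  qed
  show thesis
  proof (rule that[OF c e'])
    show "w \<in> crit_cone g x lam \<longleftrightarrow> (\<forall>v\<in>subdiff g x. (v - lam) \<bullet> w = 0)" for w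
      using K1 K2 by blast
    show "g (x + w) = ereal (c + lam \<bullet> w)" if "w \<in> crit_cone g x lam" "norm w < e'" for w
      using that K1 local_eq by blast
    show "g (x + 2 *\<^sub>R w) \<le> ereal (c + 2 * r)" if w: "norm w < e'" and eq: "g (x + w) = ereal (c + r)" for w r
    proof (rule T2)
      show "(2 *\<^sub>R w, 2 * r) \<in> T" using T(3)[OF T1[of w r], of 2] eq by simp
      show "norm (2 *\<^sub>R w) < e" using w e'le by simp
      have "lam \<bullet> w \<le> r" using sub[OF lam, of w] eq by simp
      then show "- e < 2 * r" using small[OF w] by linarith
    qed
  qed
qed

lemma subspace_crit_cone: "subspace (crit_cone g x lam)"
proof -
  obtain c e where
    K: "\<And>w. w \<in> crit_cone g x lam \<longleftrightarrow> (\<forall>v\<in>subdiff g x. (v - lam) \<bullet> w = 0)"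
    using subdiff_critical_data by metis
  show ?thesis by (auto simp: subspace_def K inner_add_right)
qed

text \<open>A subgradient \<open>v\<close> at \<open>z\<close> near \<open>lam\<close> is shown to
  be a subgradient at \<open>x\<close> as well, still in the relative interior; its maximality in
  the direction \<open>z - x\<close> then makes that direction critical. Conversely,
  \<open>v\<close> lies in the affine hull close to \<open>lam\<close>, hence in the
  subdifferential, and \<open>g\<close> is affine along critical directions.\<close>

lemma subdiff_graph_local:
  obtains e where "0 < e"
    "\<And>z v. norm (z - x) < e \<Longrightarrow> norm (v - lam) < e \<Longrightarrow>
      v \<in> subdiff g z \<longleftrightarrow> z - x \<in> crit_cone g x lam \<and> v - lam \<in> orthogonal_comp (crit_cone g x lam)"
proof -
  let ?C = "subdiff g x" and ?K = "crit_cone g x lam"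
  have lam: "lam \<in> ?C" by (rule rel_interior_subdiff_imp_subdiff)
  obtain c e where c: "g x = ereal c" and e: "0 < e"
    and K: "\<And>w. w \<in> ?K \<longleftrightarrow> (\<forall>v\<in>?C. (v - lam) \<bullet> w = 0)"
    and gK: "\<And>w. w \<in> ?K \<Longrightarrow> norm w < e \<Longrightarrow> g (x + w) = ereal (c + lam \<bullet> w)"
    and dbl: "\<And>w r. norm w < e \<Longrightarrow> g (x + w) = ereal (c + r) \<Longrightarrow> g (x + 2 *\<^sub>R w) \<le> ereal (c + 2 * r)"
    using subdiff_critical_data by blast
  let ?L = "(\<lambda>v. v - lam) ` ?C"
  have aff: "affine hull ?C = (+) lam ` span ?L"
    using affine_hull_span_gen[OF hull_inc[OF lam]] by simp
  \<comment> \<open>The orthogonal complement of \<open>?K\<close> is thereby the direction space of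
    the affine hull of the subdifferential, which is where relative interiority provides
    room.\<close>
  have KL: "?K = orthogonal_comp (span ?L)"
  proof (intro set_eqI iffI)
    fix w assume w: "w \<in> ?K"
    show "w \<in> orthogonal_comp (span ?L)"
      unfolding orthogonal_comp_def mem_Collect_eq
    proof
      fix y assume "y \<in> span ?L"
      then have "orthogonal w y"
        by (rule orthogonal_to_span) (use w in \<open>auto simp: K orthogonal_def inner_commute\<close>)
      then show "orthogonal y w" by (simp add: orthogonal_commute)
    qed
  next
    fix w assume "w \<in> orthogonal_comp (span ?L)"
    then have "\<And>v. v \<in> ?C \<Longrightarrow> orthogonal (v - lam) w"
      by (auto simp: orthogonal_comp_def span_base)
    then show "w \<in> ?K" by (simp add: K orthogonal_def)
  qed
  have Kp: "orthogonal_comp ?K = span ?L" unfolding KL by (simp add: orthogonal_comp_self)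
  obtain d where d: "d > 0" "ball lam d \<inter> affine hull ?C \<subseteq> ?C"
    using ri mem_rel_interior_ball by blast
  define e' where "e' = min e d"
  show thesis
  proof (rule that[of e'])
    show "0 < e'" using e d by (simp add: e'_def)
    fix z v assume z: "norm (z - x) < e'" and v: "norm (v - lam) < e'"
    define w where "w = z - x"
    have zw: "z = x + w" and w: "norm w < e" using z by (auto simp: w_def e'_def)
    have vball: "v \<in> ball lam d" using v by (simp add: dist_norm norm_minus_commute e'_def)
    show "v \<in> subdiff g z \<longleftrightarrow> z - x \<in> ?K \<and> v - lam \<in> orthogonal_comp ?K"
    proof (intro iffI conjI)
      assume vz: "v \<in> subdiff g z"
      then obtain r' where "g z = ereal r'" by (cases "g z") (auto simp: subdiff_def)
      then obtain r where r: "g z = ereal (c + r)" by (metis add_diff_cancel_left' diff_add_cancel add.commute)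
      have vs: "ereal (c + r) + ereal (v \<bullet> (y - z)) \<le> g y" for y
        using vz r by (auto simp: subdiff_def)
      \<comment> \<open>The subgradient inequality at \<open>z\<close> is tested at the two points
        \<open>x\<close> and \<open>x + 2 *\<^sub>R w\<close>, symmetric about \<open>z\<close>;
        together they force \<open>r = v \<bullet> w\<close>.\<close>
      have "r \<le> v \<bullet> w" using vs[of x] by (simp add: c zw inner_simps)
      moreover have "v \<bullet> w \<le> r"
      proof -
        have "ereal (c + r) + ereal (v \<bullet> (x + 2 *\<^sub>R w - z)) \<le> ereal (c + 2 * r)"
          using vs[of "x + 2 *\<^sub>R w"] dbl[OF w] r zw by (meson order_trans)
        then show ?thesis by (simp add: zw inner_simps)
      qed
      ultimately have rv: "r = v \<bullet> w" by simp
      have vC: "v \<in> ?C"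
      proof -
        have "ereal c + ereal (v \<bullet> (y - x)) \<le> g y" for y
          using vs[of y] by (simp add: rv zw inner_simps)
        then show ?thesis by (auto simp: subdiff_def c)
      qed
      then have "v - lam \<in> ?L" by blast
      then show "v - lam \<in> orthogonal_comp ?K" unfolding Kp by (rule span_base)
      have vri: "v \<in> rel_interior ?C"
      proof -
        have "v \<in> ball lam d \<inter> ?C" using vball vC by blast
        then show ?thesis using d unfolding mem_rel_interior
          by (intro exI[of _ "ball lam d"]) auto
      qed
      \<comment> \<open>The value of \<open>g\<close> at \<open>z\<close> caps every subgradient at
        \<open>x\<close>, and \<open>v\<close> attains the cap.\<close>
      have "u \<bullet> w \<le> v \<bullet> w" if "u \<in> ?C" for u
      proof -
        have "g x + ereal (u \<bullet> (z - x)) \<le> g z" using that unfolding subdiff_def by blast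
        then show ?thesis using r by (simp add: c rv zw)
      qed
      then have const: "(u - v) \<bullet> w = 0" if "u \<in> ?C" for u
        using inner_const_on_subdiff[OF vC _ vri that] by blast
      have "(u - lam) \<bullet> w = 0" if "u \<in> ?C" for u
        using const[OF that] const[OF lam] by (simp add: inner_diff_left)
      then show "z - x \<in> ?K" by (simp add: K w_def)
    next
      assume asm: "z - x \<in> ?K \<and> v - lam \<in> orthogonal_comp ?K"
      then have wK: "w \<in> ?K" and vL: "v - lam \<in> span ?L" by (auto simp: w_def Kp)
      have "v = lam + (v - lam)" by simp
      then have "v \<in> affine hull ?C" unfolding aff using vL by blast
      then have vC: "v \<in> ?C" using d vball by blast
      have "v \<bullet> w = lam \<bullet> w" using wK vC by (force simp: K inner_diff_left)
      then have "g (x + w) = ereal (c + v \<bullet> w)" using gK[OF wK w] by simp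
      then show "v \<in> subdiff g z" unfolding zw by (rule subdiff_segment[OF vC c])
    qed
  qed
qed

end

subsection \<open>Matrices and the inverse function theorem\<close>

lemma continuous_on_matrix_vector_mult:
  fixes A :: "'a::topological_space \<Rightarrow> real^'n^'m"
  assumes "continuous_on S A" "continuous_on S v"
  shows "continuous_on S (\<lambda>x. A x *v v x)"
  unfolding matrix_vector_mult_def by (intro continuous_intros assms)

lemma continuous_on_matrix_matrix_mult:
  fixes A :: "'a::topological_space \<Rightarrow> real^'n^'m" and B :: "'a \<Rightarrow> real^'k^'n"
  assumes "continuous_on S A" "continuous_on S B"
  shows "continuous_on S (\<lambda>x. A x ** B x)"
  unfolding matrix_matrix_mult_def by (intro continuous_intros assms)

lemma continuous_on_det:
  fixes A :: "'a::topological_space \<Rightarrow> real^'n^'n"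
  assumes "continuous_on S A"
  shows "continuous_on S (\<lambda>x. det (A x))"
  unfolding det_def by (intro continuous_intros assms)

lemma matrix_inv_mult:
  assumes "invertible A"
  shows "A ** matrix_inv A = mat 1" "matrix_inv A ** A = mat 1"
  using someI_ex[OF assms[unfolded invertible_def]] by (auto simp: matrix_inv_def)

lemma invertible_iff_ker:
  fixes A :: "real^'n^'n"
  shows "invertible A \<longleftrightarrow> (\<forall>x. A *v x = 0 \<longrightarrow> x = 0)"
  unfolding invertible_left_inverse matrix_left_invertible_ker ..

text \<open>By Cramer's rule the entries of the inverse are quotients of determinants, whose
  denominator does not vanish on \<open>S\<close>.\<close>

lemma continuous_on_matrix_inv:
  fixes A :: "'a::topological_space \<Rightarrow> real^'n^'n"
  assumes A: "continuous_on S A" and inv: "\<And>x. x \<in> S \<Longrightarrow> invertible (A x)"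
  shows "continuous_on S (\<lambda>x. matrix_inv (A x))"
proof -
  have det: "det (A x) \<noteq> 0" if "x \<in> S" for x using inv[OF that] by (simp add: invertible_det_nz)
  define C :: "'a \<Rightarrow> real^'n^'n" where
    "C x = (\<chi> k l. det (\<chi> i j. if j = k then (axis l 1 :: real^'n) $ i else A x $ i $ j) / det (A x))" for x
  have "matrix_inv (A x) = C x" if "x \<in> S" for x
  proof -
    have "A x *v (matrix_inv (A x) *v axis l 1) = axis l 1" for l :: 'n
      by (simp add: matrix_vector_mul_assoc matrix_inv_mult inv[OF that])
    then have "column l (matrix_inv (A x)) =
        (\<chi> k. det (\<chi> i j. if j = k then (axis l 1 :: real^'n) $ i else A x $ i $ j) / det (A x))" for l
      unfolding cramer[OF det[OF that]] by (simp add: matrix_vector_mult_basis)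
    then show ?thesis by (simp add: C_def vec_eq_iff column_def)
  qed
  moreover have "continuous_on S C"
  proof -
    have "continuous_on S (\<lambda>x. if j = k then (axis l 1 :: real^'n) $ i else A x $ i $ j)" for i j k l
      by (cases "j = k") (auto intro!: continuous_intros A)
    then show ?thesis unfolding C_def
      by (intro continuous_on_vec_lambda continuous_on_divide continuous_on_det A ballI) (use det in auto)
  qed
  ultimately show ?thesis using continuous_on_cong by (metis (no_types, lifting))
qed

text \<open>This restates \<open>inverse_function_theorem\<close> with matrices in place of bounded
  linear functions, so that the derivative of the inverse is an explicit matrix whose continuity can
  be read off.\<close>

lemma inverse_function_theorem_matrix:
  fixes f :: "real^'n \<Rightarrow> real^'n" and M :: "real^'n \<Rightarrow> real^'n^'n"
  assumes der: "\<And>x. (f has_derivative (*v) (M x)) (at x)"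
    and M: "continuous_on UNIV M" and inv: "invertible (M x0)" and N: "open N" "x0 \<in> N"
  obtains U V h where "open U" "U \<subseteq> N" "x0 \<in> U" "open V" "f x0 \<in> V" "homeomorphism U V f h"
    "\<And>y. y \<in> V \<Longrightarrow> invertible (M (h y))"
    "\<And>y. y \<in> V \<Longrightarrow> (h has_derivative (*v) (matrix_inv (M (h y)))) (at y)"
proof -
  have bl: "blinfun_apply (Blinfun ((*v) A)) = (*v) A" for A :: "real^'n^'n"
    by (rule bounded_linear_Blinfun_apply) simp
  have cont: "continuous_on N (\<lambda>x. Blinfun ((*v) (M x)))"
    by (rule continuous_on_blinfun_componentwise)
      (auto simp: bl intro!: continuous_on_matrix_vector_mult continuous_on_subset[OF M] continuous_intros)
  have id: "Blinfun ((*v) (matrix_inv (M x0))) o\<^sub>L Blinfun ((*v) (M x0)) = id_blinfun"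
    by (rule blinfun_eqI) (simp add: bl matrix_vector_mul_assoc matrix_inv_mult[OF inv])
  obtain U V h h' where UV: "open U" "U \<subseteq> N" "x0 \<in> U" "open V" "f x0 \<in> V" "homeomorphism U V f h"
    and h: "\<And>y. y \<in> V \<Longrightarrow> (h has_derivative (h' y)) (at y)"
    and h': "\<And>y. y \<in> V \<Longrightarrow> h' y = Hilbert_Choice.inv ((*v) (M (h y)))"
    and bij: "\<And>y. y \<in> V \<Longrightarrow> bij ((*v) (M (h y)))"
    using inverse_function_theorem[of N f "\<lambda>x. Blinfun ((*v) (M x))", OF N(1) _ cont N(2) id]
    unfolding bl using der by metis
  have i: "invertible (M (h y))" if "y \<in> V" for y
    using bij[OF that] by (simp add: invertible_left_inverse matrix_left_invertible_injective bij_def)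
  have "h' y = (*v) (matrix_inv (M (h y)))" if "y \<in> V" for y
    unfolding h'[OF that]
    by (rule inv_equality) (simp_all add: matrix_vector_mul_assoc matrix_inv_mult[OF i[OF that]])
  with UV h i that show thesis by metis
qed

lemma obtain_orthogonal_projection_matrix:
  fixes K :: "(real^'n) set"
  assumes K: "subspace K"
  obtains P :: "real^'n^'n"
  where "\<And>x. P *v x \<in> K" "\<And>x. x - P *v x \<in> orthogonal_comp K"
proof -
  obtain B where B: "B \<subseteq> K" "pairwise orthogonal B" "\<And>x. x \<in> B \<Longrightarrow> norm x = 1"
    and ind: "independent B" and sp: "span B = K"
    using orthonormal_basis_subspace[OF K] by metis
  have fin: "finite B" using ind by (rule independent_imp_finite)
  define p where "p x = (\<Sum>b\<in>B. (x \<bullet> b) *\<^sub>R b)" for x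
  have "linear p"
    by (rule linearI) (simp_all add: p_def inner_add_left scaleR_add_left sum.distrib scaleR_sum_right)
  then have P: "matrix p *v x = p x" for x by simp
  show thesis
  proof (rule that[of "matrix p"]; unfold P)
    show "p x \<in> K" for x
      unfolding p_def using B K by (intro subspace_sum subspace_scale) auto
    show "x - p x \<in> orthogonal_comp K" for x
    proof -
      have "orthogonal (x - p x) b" if b: "b \<in> B" for b
      proof -
        have "p x \<bullet> b = (\<Sum>b'\<in>B. if b' = b then x \<bullet> b else 0)"
          unfolding p_def inner_sum_left
        proof (rule sum.cong)
          fix b' assume "b' \<in> B"
          then show "(x \<bullet> b') *\<^sub>R b' \<bullet> b = (if b' = b then x \<bullet> b else 0)"
            using B b by (auto simp: pairwise_def orthogonal_def dot_square_norm)
        qed simp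
        then show ?thesis using fin b by (simp add: orthogonal_def inner_diff_left)
      qed
      then show ?thesis unfolding orthogonal_comp_def
        using orthogonal_to_span[of _ B "x - p x"] by (auto simp: sp orthogonal_commute)
    qed
  qed
qed

subsection \<open>Localizations of smooth equations\<close>

lemma lip_localization_unique:
  assumes "lip_localization S y0 x0 \<sigma> U V" "y \<in> V" "x \<in> S y" "x \<in> U"
  shows "\<sigma> y = x"
proof -
  have "S y \<inter> U = {\<sigma> y}" using assms(1,2) unfolding lip_localization_def by blast
  then have "x \<in> {\<sigma> y}" using assms(3,4) by blast
  then show ?thesis by simp
qed

context
  fixes f :: "real^'n \<Rightarrow> real^'n" and M :: "real^'n \<Rightarrow> real^'n^'n" and P :: "real^'n^'n"
    and S :: "real^'n \<Rightarrow> (real^'n) set" and x0 :: "real^'n" and N N0 :: "(real^'n) set"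
  assumes der: "\<And>x. (f has_derivative (*v) (M x)) (at x)"
    and M: "continuous_on UNIV M" and f0: "f x0 = 0"
    and N: "open N" "x0 \<in> N" and N0: "open N0" "0 \<in> N0"
    and S: "\<And>x y. x \<in> N \<Longrightarrow> y \<in> N0 \<Longrightarrow> x \<in> S y \<longleftrightarrow> f x = P *v y"
begin

lemma lip_localization_base:
  assumes "lip_localization S 0 x0 \<sigma> U V"
  shows "x0 \<in> U" "0 \<in> V" "\<sigma> 0 = x0"
proof -
  show *: "x0 \<in> U" "0 \<in> V"
    using assms by (auto simp: lip_localization_def dest: eventually_nhds_x_imp_x)
  have "x0 \<in> S 0" using S[OF N(2) N0(2)] f0 by simp
  then show "\<sigma> 0 = x0" using lip_localization_unique[OF assms *(2) _ *(1)] by blast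
qed

text \<open>Along a kernel direction \<open>f\<close> is of order \<open>o(t)\<close>, whereas the localization, being a Lipschitz
  left inverse of \<open>f\<close> there, forces linear growth.\<close>

lemma lip_localization_imp_kernel_trivial:
  assumes lip: "lip_localization S 0 x0 \<sigma> U V"
    and h: "M x0 *v h = 0" and P: "\<And>t. P *v f (x0 + t *\<^sub>R h) = f (x0 + t *\<^sub>R h)"
  shows "h = 0"
proof -
  obtain C where C: "C-lipschitz_on V \<sigma>" using lip by (auto simp: lip_localization_def)
  define y where "y t = f (x0 + t *\<^sub>R h)" for t :: real
  have y0: "y 0 = 0" by (simp add: y_def f0)
  have "((\<lambda>t::real. x0 + t *\<^sub>R h) has_derivative (\<lambda>t. t *\<^sub>R h)) (at 0)"
    by (auto intro!: derivative_eq_intros)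
  moreover have "(f has_derivative (*v) (M x0)) (at (x0 + 0 *\<^sub>R h))" using der by simp
  ultimately have "(y has_derivative (\<lambda>t. M x0 *v (t *\<^sub>R h))) (at 0)"
    unfolding y_def by (rule has_derivative_compose)
  then have dy: "(y has_derivative (\<lambda>t. 0)) (at 0)"
    by (simp add: matrix_vector_mult_scaleR h)
  then have lim: "((\<lambda>t. norm (y t) / norm t) \<longlongrightarrow> 0) (at 0)"
    by (simp add: has_derivative_at y0)
  have ty: "(y \<longlongrightarrow> 0) (at 0)"
    using has_derivative_continuous[OF dy] by (simp add: isCont_def y0)
  have tx: "((\<lambda>t::real. x0 + t *\<^sub>R h) \<longlongrightarrow> x0) (at 0)"
    by (auto intro!: tendsto_eq_intros)
  have "\<forall>\<^sub>F x in nhds x0. x \<in> U \<inter> N"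
    using lip eventually_nhds_in_open[OF N] by (auto simp: lip_localization_def eventually_conj_iff)
  then have eU: "\<forall>\<^sub>F t::real in at 0. x0 + t *\<^sub>R h \<in> U \<inter> N"
    using tx by (rule eventually_compose_filterlim)
  have "\<forall>\<^sub>F y in nhds 0. y \<in> V \<inter> N0"
    using lip eventually_nhds_in_open[OF N0] by (auto simp: lip_localization_def eventually_conj_iff)
  then have eV: "\<forall>\<^sub>F t in at 0. y t \<in> V \<inter> N0"
    using ty by (rule eventually_compose_filterlim)
  have "\<forall>\<^sub>F t::real in at 0. t \<noteq> 0" by (simp add: eventually_neq_at_within)
  with eU eV have "\<forall>\<^sub>F t in at 0. norm h \<le> C * (norm (y t) / norm t)"
  proof eventually_elim
    case (elim t)
    \<comment> \<open>Since \<open>P\<close> fixes the values of \<open>f\<close> on this line,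
      \<open>y t\<close> itself can serve as the parameter.\<close>
    have "x0 + t *\<^sub>R h \<in> S (y t)" using S elim P by (simp add: y_def)
    then have \<sigma>: "\<sigma> (y t) = x0 + t *\<^sub>R h" using elim by (intro lip_localization_unique[OF lip]) auto
    have "dist (\<sigma> (y t)) (\<sigma> 0) \<le> C * dist (y t) 0"
      using elim lip_localization_base[OF lip] by (intro lipschitz_onD[OF C]) auto
    then have "\<bar>t\<bar> * norm h \<le> C * norm (y t)"
      by (simp add: \<sigma> lip_localization_base[OF lip] dist_norm)
    then show ?case using elim by (simp add: field_simps)
  qed
  moreover have "((\<lambda>t. C * (norm (y t) / norm t)) \<longlongrightarrow> C * 0) (at 0)"
    by (intro tendsto_intros lim)
  ultimately have "norm h \<le> C * 0"
    by (intro tendsto_lowerbound[of _ "C * 0" "at (0::real)"]) auto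
  then show "h = 0" by simp
qed

text \<open>With \<open>h\<close> the local inverse of \<open>f\<close>, the equation
  \<open>f x = P *v y\<close> has the solution \<open>h (P *v y)\<close>. A bounded derivative on a
  small ball, which is convex, makes it Lipschitz.\<close>

lemma exists_lip_localization:
  assumes inv: "invertible (M x0)"
  shows "\<exists>\<sigma> U V. lip_localization S 0 x0 \<sigma> U V"
proof -
  obtain U V h where U: "open U" "U \<subseteq> N" "x0 \<in> U" and V: "open V" "f x0 \<in> V"
    and hom: "homeomorphism U V f h"
    and invh: "\<And>y. y \<in> V \<Longrightarrow> invertible (M (h y))"
    and h: "\<And>y. y \<in> V \<Longrightarrow> (h has_derivative (*v) (matrix_inv (M (h y)))) (at y)"
    using inverse_function_theorem_matrix[OF der M inv N] by metis
  define D where "D y = matrix_inv (M (h y)) ** P" for y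
  \<comment> \<open>The sum of absolute entries is a bound for the operator norm that is visibly
    continuous; near 0 it exceeds its value there by less than 1.\<close>
  define b where "b y = (\<Sum>i\<in>UNIV. \<Sum>j\<in>UNIV. \<bar>D y $ i $ j\<bar>)" for y
  have hc: "continuous_on V h" using hom by (simp add: homeomorphism_def)
  have Dc: "continuous_on V D" unfolding D_def
    by (intro continuous_on_matrix_matrix_mult continuous_on_matrix_inv invh
        continuous_on_compose2[OF M hc] continuous_on_const) auto
  have bc: "continuous_on V b" unfolding b_def by (intro continuous_intros Dc)
  have Pc: "continuous_on UNIV ((*v) P)" by (intro continuous_on_matrix_vector_mult continuous_intros)
  have V0: "P *v 0 \<in> V" using V f0 by simp
  have op: "open {y. P *v y \<in> V}" using open_vimage[OF V(1) Pc] by (simp add: vimage_def)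
  have bPc: "continuous_on {y. P *v y \<in> V} (\<lambda>y. b (P *v y))"
    by (rule continuous_on_compose2[OF bc]) (auto intro: continuous_on_subset[OF Pc])
  have "isCont (\<lambda>y. b (P *v y)) 0"
    using continuous_on_eq_continuous_at[THEN iffD1, OF op bPc, rule_format, of 0] V0 by simp
  then have "(\<lambda>y. b (P *v y)) \<midarrow>0\<rightarrow> b (P *v 0)" by (rule isContD)
  then have "\<forall>\<^sub>F y in nhds 0. b (P *v y) < b (P *v 0) + 1"
    by (intro order_tendstoD[OF tendsto_at_iff_tendsto_nhds[THEN iffD1]]) auto
  then have "\<forall>\<^sub>F y in nhds 0. b (P *v y) < b (P *v 0) + 1 \<and> y \<in> N0 \<and> y \<in> {y. P *v y \<in> V}"
    using eventually_nhds_in_open[OF N0] eventually_nhds_in_open[OF op, of 0] V0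
    by (auto simp: eventually_conj_iff)
  then obtain r where r: "r > 0"
    "\<And>y. y \<in> ball 0 r \<Longrightarrow> b (P *v y) < b (P *v 0) + 1 \<and> y \<in> N0 \<and> P *v y \<in> V"
    by (auto simp: eventually_nhds_metric dist_commute)
  define \<sigma> where "\<sigma> y = h (P *v y)" for y
  have "(b (P *v 0) + 1)-lipschitz_on (ball 0 r) \<sigma>"
  proof (rule bounded_derivative_imp_lipschitz)
    fix y :: "real^'n" assume y: "y \<in> ball 0 r"
    have "((*v) P has_derivative (*v) P) (at y)"
      by (rule bounded_linear_imp_has_derivative) simp
    from has_derivative_compose[OF this h] r(2)[OF y]
    have "(\<sigma> has_derivative (*v) (D (P *v y))) (at y)"
      by (simp add: \<sigma>_def[abs_def] D_def matrix_vector_mul_assoc)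
    then show "(\<sigma> has_derivative (*v) (D (P *v y))) (at y within ball 0 r)"
      by (rule has_derivative_at_withinI)
    have "onorm ((*v) (D (P *v y))) \<le> b (P *v y)"
      unfolding b_def by (rule onorm_le_matrix_component_sum)
    also have "\<dots> \<le> b (P *v 0) + 1" using r(2)[OF y] by simp
    finally show "onorm ((*v) (D (P *v y))) \<le> b (P *v 0) + 1" .
  next
    show "0 \<le> b (P *v 0) + 1" unfolding b_def by (intro add_nonneg_nonneg sum_nonneg) auto
  qed auto
  moreover have "S y \<inter> U = {\<sigma> y}" if "y \<in> ball 0 r" for y
  proof -
    have y: "y \<in> N0" "P *v y \<in> V" using r(2)[OF that] by auto
    have "x \<in> S y \<longleftrightarrow> x = \<sigma> y" if x: "x \<in> U" for x
    proof -
      have "x \<in> S y \<longleftrightarrow> f x = P *v y" using S x y(1) U(2) by blast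
      also have "\<dots> \<longleftrightarrow> x = h (P *v y)"
        using homeomorphism_apply1[OF hom x] homeomorphism_apply2[OF hom y(2)] by metis
      finally show ?thesis by (simp add: \<sigma>_def)
    qed
    moreover have "\<sigma> y \<in> U" using y hom by (auto simp: \<sigma>_def homeomorphism_def)
    ultimately show ?thesis by auto
  qed
  ultimately have "lip_localization S 0 x0 \<sigma> U (ball 0 r)"
    using eventually_nhds_in_open[OF U(1,3)] eventually_nhds_in_open[OF open_ball, of "0 :: real^'n" 0 r] r(1)
    unfolding lip_localization_def by (intro conjI ballI exI) auto
  then show ?thesis by blast
qed

text \<open>Any given localization agrees near 0 with \<open>h (P *v y)\<close>: it is continuous
  with \<open>\<sigma> 0 = x0\<close>, so its values enter the domain \<open>U'\<close> on which
  \<open>f\<close> is inverted by \<open>h\<close>.\<close>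

lemma lip_localization_has_derivative:
  assumes inv: "invertible (M x0)" and lip: "lip_localization S 0 x0 \<sigma> U V"
  obtains W where "open W" "0 \<in> W" "continuous_on W \<sigma>"
    "\<And>y. y \<in> W \<Longrightarrow> invertible (M (\<sigma> y))"
    "\<And>y. y \<in> W \<Longrightarrow> (\<sigma> has_derivative (*v) (matrix_inv (M (\<sigma> y)) ** P)) (at y)"
proof -
  obtain U' V' h where U': "open U'" "U' \<subseteq> N" "x0 \<in> U'" and V': "open V'" "f x0 \<in> V'"
    and hom: "homeomorphism U' V' f h"
    and invh: "\<And>y. y \<in> V' \<Longrightarrow> invertible (M (h y))"
    and h: "\<And>y. y \<in> V' \<Longrightarrow> (h has_derivative (*v) (matrix_inv (M (h y)))) (at y)"
    using inverse_function_theorem_matrix[OF der M inv N] by metis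
  obtain C where "C-lipschitz_on V \<sigma>" using lip by (auto simp: lip_localization_def)
  then have cV: "continuous_on V \<sigma>" by (rule lipschitz_on_continuous_on)
  have "\<forall>\<^sub>F y in nhds 0. y \<in> V" using lip by (auto simp: lip_localization_def)
  then obtain B where B: "open B" "0 \<in> B" "B \<subseteq> V" by (auto simp: eventually_nhds)
  define W where "W = (B \<inter> N0) \<inter> \<sigma> -` U'"
  have cB: "continuous_on (B \<inter> N0) \<sigma>" using cV by (rule continuous_on_subset) (use B in auto)
  have W: "open W" unfolding W_def
    using continuous_on_open_vimage[of "B \<inter> N0" \<sigma>] cB B(1) N0(1) U'(1) by (auto simp: Int_commute)
  have cW: "continuous_on W \<sigma>" using cB by (rule continuous_on_subset) (auto simp: W_def)
  have key: "P *v y \<in> V' \<and> \<sigma> y = h (P *v y)" if "y \<in> W" for y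
  proof -
    have y: "y \<in> V" "y \<in> N0" "\<sigma> y \<in> U'" using that B by (auto simp: W_def)
    then have "\<sigma> y \<in> S y" using lip by (auto simp: lip_localization_def)
    then have "f (\<sigma> y) = P *v y" using S y U' by blast
    then show ?thesis using hom y by (metis homeomorphism_apply1 homeomorphism_image1 image_eqI)
  qed
  show thesis
  proof (rule that[OF W _ cW])
    show "0 \<in> W" using B N0 U' lip_localization_base[OF lip] by (auto simp: W_def)
    fix y assume y: "y \<in> W"
    show "invertible (M (\<sigma> y))" using key[OF y] invh by simp
    have "((*v) P has_derivative (*v) P) (at y)"
      by (rule bounded_linear_imp_has_derivative) simp
    from has_derivative_compose[OF this h] key[OF y]
    have "((\<lambda>y. h (P *v y)) has_derivative (*v) (matrix_inv (M (\<sigma> y)) ** P)) (at y)"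
      by (simp add: matrix_vector_mul_assoc)
    then show "(\<sigma> has_derivative (*v) (matrix_inv (M (\<sigma> y)) ** P)) (at y)"
      by (rule has_derivative_transform_within_open[OF _ W y]) (use key in auto)
  qed
qed

end

subsection \<open>Reduction to the critical subspace\<close>

text \<open>For \<open>P\<close> the orthogonal projection onto \<open>K\<close>, this is block
  triangular with respect to \<open>K\<close> and its complement, with the compression of
  \<open>A\<close> to \<open>K\<close> and the identity on the diagonal. It expresses invertibility
  of the compression without choosing a basis.\<close>

definition reduced_matrix :: "real^'n^'n \<Rightarrow> real^'n^'n \<Rightarrow> real^'n^'n" where
  "reduced_matrix P A = P ** A + (mat 1 - P)"

lemma reduced_matrix_mult: "reduced_matrix P A *v h = P *v (A *v h) + (h - P *v h)"
  by (simp add: reduced_matrix_def matrix_vector_mult_add_rdistrib matrix_vector_mult_diff_rdistrib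
      matrix_vector_mul_assoc)

context
  fixes K :: "(real^'n) set" and P :: "real^'n^'n"
  assumes K: "subspace K" and PK: "\<And>x. P *v x \<in> K" and PO: "\<And>x. x - P *v x \<in> orthogonal_comp K"
begin

lemma mem_orthogonal_comp_imp_zero: "v \<in> K \<Longrightarrow> v \<in> orthogonal_comp K \<Longrightarrow> v = 0"
  by (auto simp: orthogonal_comp_def orthogonal_self)

lemma proj_ident: "v \<in> K \<Longrightarrow> P *v v = v"
  using mem_orthogonal_comp_imp_zero[of "v - P *v v"] subspace_diff[OF K _ PK] PO by force

lemma proj_zero_iff: "P *v v = 0 \<longleftrightarrow> v \<in> orthogonal_comp K"
proof
  assume v: "v \<in> orthogonal_comp K"
  have "v - (v - P *v v) \<in> orthogonal_comp K"
    by (rule subspace_diff[OF subspace_orthogonal_comp v PO])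
  then show "P *v v = 0" using mem_orthogonal_comp_imp_zero PK by simp
qed (metis PO diff_zero)

text \<open>The equation rearranges to an identity between a vector of the complement and a vector
  of \<open>K\<close>, so both vanish. It serves twice: for the nonlinear inclusion and, with
  \<open>a = A *v h\<close> and \<open>w = h\<close>, for its linearization.\<close>

lemma reduced_equation_iff:
  "P *v a + (w - P *v w) = P *v b \<longleftrightarrow> w \<in> K \<and> b - a \<in> orthogonal_comp K"
proof
  assume eq: "P *v a + (w - P *v w) = P *v b"
  then have "w - P *v w = P *v (b - a)" by (simp add: matrix_vector_mult_diff_distrib algebra_simps)
  then have "P *v (b - a) = 0" "w - P *v w = 0"
    using mem_orthogonal_comp_imp_zero[of "w - P *v w"] PK PO by metis+
  then show "w \<in> K \<and> b - a \<in> orthogonal_comp K"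
    using PK[of w] by (simp add: proj_zero_iff)
next
  assume "w \<in> K \<and> b - a \<in> orthogonal_comp K"
  then have "P *v w = w" "P *v (b - a) = 0" using proj_ident proj_zero_iff by auto
  then show "P *v a + (w - P *v w) = P *v b" by (simp add: matrix_vector_mult_diff_distrib)
qed

lemma reduced_matrix_mult_eq_iff:
  "reduced_matrix P A *v h = P *v v \<longleftrightarrow> h \<in> K \<and> v - A *v h \<in> orthogonal_comp K"
  unfolding reduced_matrix_mult by (rule reduced_equation_iff)

lemma reduced_matrix_kernel_iff:
  "reduced_matrix P A *v h = 0 \<longleftrightarrow> h \<in> K \<and> A *v h \<in> orthogonal_comp K"
  using reduced_matrix_mult_eq_iff[of A h 0] subspace_neg[OF subspace_orthogonal_comp, of "A *v h" K]
    subspace_neg[OF subspace_orthogonal_comp, of "- (A *v h)" K] by auto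

lemma invertible_reduced_matrix_iff_kernel:
  "invertible (reduced_matrix P A) \<longleftrightarrow> {w. A *v w \<in> orthogonal_comp K} \<inter> K = {0}"
proof -
  have "0 \<in> K" "0 \<in> orthogonal_comp K" using K by (auto simp: subspace_0 subspace_orthogonal_comp)
  then show ?thesis unfolding invertible_iff_ker reduced_matrix_kernel_iff by auto
qed

lemma invertible_reduced_matrix_iff_sum:
  "invertible (reduced_matrix P A) \<longleftrightarrow> (\<forall>z. \<exists>k p. k \<in> K \<and> p \<in> orthogonal_comp K \<and> z = A *v k + p)"
proof
  assume inv: "invertible (reduced_matrix P A)"
  show "\<forall>z. \<exists>k p. k \<in> K \<and> p \<in> orthogonal_comp K \<and> z = A *v k + p"
  proof
    fix z
    define h where "h = matrix_inv (reduced_matrix P A) *v (P *v z)"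
    have "reduced_matrix P A *v h = P *v z"
      unfolding h_def matrix_vector_mul_assoc[of "reduced_matrix P A"] by (simp add: matrix_inv_mult[OF inv])
    then have "h \<in> K \<and> z - A *v h \<in> orthogonal_comp K" by (simp add: reduced_matrix_mult_eq_iff)
    then show "\<exists>k p. k \<in> K \<and> p \<in> orthogonal_comp K \<and> z = A *v k + p"
      by (intro exI[of _ h] exI[of _ "z - A *v h"]) auto
  qed
next
  assume sum: "\<forall>z. \<exists>k p. k \<in> K \<and> p \<in> orthogonal_comp K \<and> z = A *v k + p"
  have "\<exists>h. reduced_matrix P A *v h = z" for z
  proof -
    \<comment> \<open>The preimage of \<open>z\<close> is \<open>k + q\<close>. Its component
      \<open>q\<close> in the complement is dictated by \<open>z\<close>; decomposing
      \<open>z - A *v q\<close> rather than \<open>z\<close> compensates for the contribution of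
      \<open>A *v q\<close>.\<close>
    define q where "q = z - P *v z"
    obtain k p where kp: "k \<in> K" "p \<in> orthogonal_comp K" "z - A *v q = A *v k + p" using sum by metis
    have "P *v q = 0" "P *v p = 0" "P *v k = k"
      using kp PO by (auto simp: proj_ident proj_zero_iff q_def)
    then have Pkq: "P *v (k + q) = k" by (simp add: matrix_vector_right_distrib)
    have "A *v (k + q) = z - p" using kp(3) by (simp add: matrix_vector_right_distrib algebra_simps)
    then have "P *v (A *v (k + q)) = P *v z"
      using \<open>P *v p = 0\<close> by (simp add: matrix_vector_mult_diff_distrib)
    then have "reduced_matrix P A *v (k + q) = P *v z + q"
      unfolding reduced_matrix_mult Pkq by simp
    then have "reduced_matrix P A *v (k + q) = z" by (simp add: q_def)
    then show ?thesis by blast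
  qed
  then show "invertible (reduced_matrix P A)"
    unfolding invertible_right_inverse matrix_right_invertible_surjective by (auto simp: surj_def) metis
qed

text \<open>Duality: decomposing a kernel vector as \<open>w = A *v k + p\<close>, both parts are
  orthogonal to \<open>w\<close>, the first after moving \<open>A\<close> across the inner product.
  Hence \<open>w \<bullet> w = 0\<close>.\<close>

lemma invertible_reduced_matrix_transpose:
  assumes "invertible (reduced_matrix P A)"
  shows "invertible (reduced_matrix P (transpose A))"
  unfolding invertible_iff_ker reduced_matrix_kernel_iff
proof (intro allI impI)
  fix w assume w: "w \<in> K \<and> transpose A *v w \<in> orthogonal_comp K"
  obtain k p where kp: "k \<in> K" "p \<in> orthogonal_comp K" "w = A *v k + p"
    using assms invertible_reduced_matrix_iff_sum by metis
  have "w \<bullet> p = 0" using kp(2) w by (auto simp: orthogonal_comp_def orthogonal_def)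
  moreover have "w \<bullet> (A *v k) = (transpose A *v w) \<bullet> k"
    by (simp only: transpose_matrix_vector dot_lmul_matrix)
  moreover have "(transpose A *v w) \<bullet> k = 0"
    using kp(1) w by (simp add: orthogonal_comp_def orthogonal_def inner_commute)
  moreover have "w \<bullet> w = w \<bullet> (A *v k) + w \<bullet> p" using kp(3) by (metis inner_add_right)
  ultimately have "w \<bullet> w = 0" by simp
  then show "w = 0" by simp
qed

lemma invertible_reduced_matrix_iff_transpose_kernel:
  "invertible (reduced_matrix P A) \<longleftrightarrow> {w. transpose A *v w \<in> orthogonal_comp K} \<inter> K = {0}"
  unfolding invertible_reduced_matrix_iff_kernel[symmetric]
  using invertible_reduced_matrix_transpose transpose_transpose by metis

text \<open>Both sides send \<open>v\<close> to the unique \<open>h\<close> in \<open>K\<close> for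
  which \<open>v - A *v h\<close> is orthogonal to \<open>K\<close>; the left side computes it in
  the coordinates given by \<open>B\<close>.\<close>

lemma matrix_inv_reduced_matrix_basis:
  fixes B :: "real^'s^'n"
  assumes inv: "invertible (reduced_matrix P A)"
    and sp: "span (columns B) = K" and card: "CARD('s) = dim K"
  shows "B ** matrix_inv (transpose B ** A ** B) ** transpose B = matrix_inv (reduced_matrix P A) ** P"
proof -
  \<comment> \<open>As many columns as the dimension of their span means full column rank.\<close>
  have inj: "inj ((*v) B)"
    using card sp by (metis full_rank_injective column_rank_def dim_span)
  have BK: "B *v c \<in> K" for c using matrix_vector_mult_in_columnspace sp by blast
  have orth: "z \<in> orthogonal_comp K" if "transpose B *v z = 0" for z
  proof -
    have "orthogonal z y" if y: "y \<in> columns B" for y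
    proof -
      obtain i where "y = B *v axis i 1" using y by (auto simp: columns_image_basis)
      then have "z \<bullet> y = (transpose B *v z) \<bullet> axis i 1"
        by (simp add: transpose_matrix_vector dot_lmul_matrix)
      then show ?thesis using \<open>transpose B *v z = 0\<close> by (simp add: orthogonal_def)
    qed
    then show ?thesis unfolding orthogonal_comp_def
      using orthogonal_to_span[of _ "columns B" z] by (auto simp: sp orthogonal_commute)
  qed
  let ?C = "transpose B ** A ** B"
  have C: "?C *v c = transpose B *v (A *v (B *v c))" for c
    by (simp add: matrix_vector_mul_assoc matrix_mul_assoc)
  have invC: "invertible ?C"
    unfolding invertible_iff_ker
  proof (intro allI impI)
    fix c assume "?C *v c = 0"
    then have "A *v (B *v c) \<in> orthogonal_comp K" unfolding C by (rule orth)
    then have "reduced_matrix P A *v (B *v c) = 0" using BK by (simp add: reduced_matrix_kernel_iff)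
    then have "B *v c = B *v 0" using inv by (simp add: invertible_iff_ker)
    then show "c = 0" by (rule injD[OF inj])
  qed
  have "(B ** matrix_inv ?C ** transpose B) *v v = (matrix_inv (reduced_matrix P A) ** P) *v v" for v
  proof -
    define c where "c = matrix_inv ?C *v (transpose B *v v)"
    have "?C *v c = transpose B *v v"
      unfolding c_def matrix_vector_mul_assoc[of ?C] by (simp add: matrix_inv_mult[OF invC])
    then have "transpose B *v (v - A *v (B *v c)) = 0"
      unfolding C by (simp add: matrix_vector_mult_diff_distrib)
    then have "reduced_matrix P A *v (B *v c) = P *v v"
      using orth BK by (simp add: reduced_matrix_mult_eq_iff)
    then have "matrix_inv (reduced_matrix P A) *v (reduced_matrix P A *v (B *v c)) =
        matrix_inv (reduced_matrix P A) *v (P *v v)" by simp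
    then have "B *v c = matrix_inv (reduced_matrix P A) *v (P *v v)"
      unfolding matrix_vector_mul_assoc[of _ "reduced_matrix P A"] by (simp add: matrix_inv_mult[OF inv])
    then show ?thesis
      by (simp add: c_def matrix_vector_mul_assoc matrix_mul_assoc del: transpose_matrix_vector)
  qed
  then show ?thesis by (simp add: matrix_eq)
qed

end

section \<open>The inclusion for \<open>\<psi>\<close> and \<open>g\<close> as a smooth equation,
  and the resulting localization\<close>

theorem theorem5p4:
  fixes \<psi> :: "real^'m \<Rightarrow> real^'m"
    and J :: "real^'m \<Rightarrow> real^'m^'m"
    and g :: "real^'m \<Rightarrow> ereal"
    and xbar :: "real^'m"
  assumes deriv: "\<And>x. (\<psi> has_derivative (\<lambda>h. J x *v h)) (at x)"
    and C1: "continuous_on UNIV J"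
    and poly: "polyhedral_fun g"
    and nondeg: "- \<psi> xbar \<in> rel_interior (subdiff g xbar)"
  defines "Kbar \<equiv> crit_cone g xbar (- \<psi> xbar)"
  shows
    "((\<forall>z. \<exists>k p. k \<in> Kbar \<and> p \<in> orthogonal_comp Kbar \<and> z = J xbar *v k + p)
        \<longleftrightarrow> {w. transpose (J xbar) *v w \<in> orthogonal_comp Kbar} \<inter> Kbar = {0})
     \<and> ((\<exists>\<sigma> U V. lip_localization (sol_map \<psi> g) 0 xbar \<sigma> U V)
        \<longleftrightarrow> (\<forall>z. \<exists>k p. k \<in> Kbar \<and> p \<in> orthogonal_comp Kbar \<and> z = J xbar *v k + p))
     \<and> (\<forall>\<sigma> U V. lip_localization (sol_map \<psi> g) 0 xbar \<sigma> U V \<longrightarrow>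
          (\<exists>W. open W \<and> 0 \<in> W \<and>
             (\<exists>D. (\<forall>y\<in>W. (\<sigma> has_derivative (\<lambda>v. D y *v v)) (at y)) \<and> continuous_on W D)
           \<and> (Kbar = {0} \<longrightarrow> (\<forall>y\<in>W. (\<sigma> has_derivative (\<lambda>v. 0)) (at y)))
           \<and> (\<forall>B :: real^'s^'m. (columns B \<subseteq> Kbar \<and> span (columns B) = Kbar
                 \<and> CARD('s) = dim Kbar) \<longrightarrow>
               (\<forall>y\<in>W. (\<sigma> has_derivative
                   (\<lambda>v. (B ** matrix_inv (transpose B ** J (\<sigma> y) ** B) ** transpose B) *v v)) (at y)))))"
proof -
  have K: "subspace Kbar" unfolding Kbar_def by (rule subspace_crit_cone[OF poly nondeg])
  obtain P :: "real^'m^'m" where P: "\<And>x. P *v x \<in> Kbar" "\<And>x. x - P *v x \<in> orthogonal_comp Kbar"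
    using obtain_orthogonal_projection_matrix[OF K] by blast
  note proj = K P
  define M where "M x = reduced_matrix P (J x)" for x
  define f where "f x = P *v (\<psi> x - \<psi> xbar) + ((x - xbar) - P *v (x - xbar))" for x
  let ?inv = "invertible (M xbar)"
  have a_iff: "?inv \<longleftrightarrow> (\<forall>z. \<exists>k p. k \<in> Kbar \<and> p \<in> orthogonal_comp Kbar \<and> z = J xbar *v k + p)"
    unfolding M_def by (rule invertible_reduced_matrix_iff_sum[OF proj])
  have b_iff: "?inv \<longleftrightarrow> {w. transpose (J xbar) *v w \<in> orthogonal_comp Kbar} \<inter> Kbar = {0}"
    unfolding M_def by (rule invertible_reduced_matrix_iff_transpose_kernel[OF proj])
  have contM: "continuous_on UNIV M"
    unfolding M_def reduced_matrix_def
    by (intro continuous_intros continuous_on_matrix_matrix_mult C1)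
  have der: "(f has_derivative (*v) (M x)) (at x)" for x
  proof -
    note bl = bounded_linear.has_derivative[OF matrix_vector_mul_bounded_linear[of P]]
    have "((\<lambda>x. \<psi> x - \<psi> xbar) has_derivative (*v) (J x)) (at x)"
      using has_derivative_diff[OF deriv[of x] has_derivative_const[of "\<psi> xbar"]] by simp
    moreover have "((\<lambda>x. x - xbar) has_derivative (\<lambda>h. h)) (at x)"
      by (auto intro!: derivative_eq_intros)
    ultimately have "(f has_derivative (\<lambda>h. P *v (J x *v h) + (h - P *v h))) (at x)"
      unfolding f_def by (intro has_derivative_add has_derivative_diff bl)
    then show ?thesis by (simp add: M_def reduced_matrix_mult[abs_def])
  qed
  have f0: "f xbar = 0" by (simp add: f_def)
  obtain e where e: "0 < e" and graph: "\<And>z v. norm (z - xbar) < e \<Longrightarrow> norm (v - - \<psi> xbar) < e \<Longrightarrow>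
      v \<in> subdiff g z \<longleftrightarrow> z - xbar \<in> Kbar \<and> v - - \<psi> xbar \<in> orthogonal_comp Kbar"
    using subdiff_graph_local[OF poly nondeg] unfolding Kbar_def by metis
  \<comment> \<open>The two halves of \<open>e\<close> leave \<open>y - \<psi> x\<close> within
    \<open>e\<close> of \<open>- \<psi> xbar\<close>, so the local description of the
    subdifferential graph applies.\<close>
  define N where "N = ball xbar e \<inter> \<psi> -` ball (\<psi> xbar) (e / 2)"
  define N0 :: "(real^'m) set" where "N0 = ball 0 (e / 2)"
  have "continuous_on UNIV \<psi>"
    using deriv has_derivative_continuous by (blast intro: continuous_at_imp_continuous_on)
  then have N: "open N" "xbar \<in> N" and N0: "open N0" "0 \<in> N0"
    using e by (auto simp: N_def N0_def intro!: open_Int open_vimage)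
  have S: "x \<in> sol_map \<psi> g y \<longleftrightarrow> f x = P *v y" if "x \<in> N" "y \<in> N0" for x y
  proof -
    have x: "norm (x - xbar) < e" and "norm (\<psi> xbar - \<psi> x) < e / 2" "norm y < e / 2"
      using that by (auto simp: N_def N0_def dist_norm norm_minus_commute)
    then have "norm (y + (\<psi> xbar - \<psi> x)) < e"
      using norm_triangle_ineq[of y "\<psi> xbar - \<psi> x"] by linarith
    moreover have eq: "y - \<psi> x - - \<psi> xbar = y - (\<psi> x - \<psi> xbar)" by simp
    ultimately have "norm (y - \<psi> x - - \<psi> xbar) < e" by (simp add: algebra_simps)
    from graph[OF x this]
    have "y - \<psi> x \<in> subdiff g x \<longleftrightarrow> x - xbar \<in> Kbar \<and> y - (\<psi> x - \<psi> xbar) \<in> orthogonal_comp Kbar"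
      unfolding eq .
    also have "\<dots> \<longleftrightarrow> f x = P *v y" unfolding f_def by (rule reduced_equation_iff[OF proj, symmetric])
    also have "y - \<psi> x \<in> subdiff g x \<longleftrightarrow> x \<in> sol_map \<psi> g y"
      by (auto simp: sol_map_def) (metis add_diff_cancel_left' add.commute diff_add_cancel)
    finally show ?thesis .
  qed
  note localized = der contM f0 N N0 S
  \<comment> \<open>Kernel vectors of \<open>M xbar\<close> lie in \<open>Kbar\<close>, so on the
    line through \<open>xbar\<close> in such a direction the complementary part of \<open>f\<close>
    vanishes and \<open>P\<close> fixes its values.\<close>
  have lip_inv: ?inv if lip: "lip_localization (sol_map \<psi> g) 0 xbar \<sigma> U V" for \<sigma> U V
    unfolding invertible_iff_ker
  proof (intro allI impI)
    fix h assume h: "M xbar *v h = 0"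
    then have "h \<in> Kbar" by (simp add: M_def reduced_matrix_kernel_iff[OF proj])
    then have "t *\<^sub>R h \<in> Kbar" for t using K by (simp add: subspace_scale)
    then have "f (xbar + t *\<^sub>R h) \<in> Kbar" for t
      using P(1) by (simp add: f_def proj_ident[OF proj])
    then show "h = 0"
      using lip_localization_imp_kernel_trivial[OF localized lip h] proj_ident[OF proj] by blast
  qed
  have "\<exists>W. open W \<and> 0 \<in> W \<and>
             (\<exists>D. (\<forall>y\<in>W. (\<sigma> has_derivative (\<lambda>v. D y *v v)) (at y)) \<and> continuous_on W D)
           \<and> (Kbar = {0} \<longrightarrow> (\<forall>y\<in>W. (\<sigma> has_derivative (\<lambda>v. 0)) (at y)))
           \<and> (\<forall>B :: real^'s^'m. (columns B \<subseteq> Kbar \<and> span (columns B) = Kbar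
                 \<and> CARD('s) = dim Kbar) \<longrightarrow>
               (\<forall>y\<in>W. (\<sigma> has_derivative
                   (\<lambda>v. (B ** matrix_inv (transpose B ** J (\<sigma> y) ** B) ** transpose B) *v v)) (at y)))"
    if lip: "lip_localization (sol_map \<psi> g) 0 xbar \<sigma> U V" for \<sigma> U V
  proof -
    obtain W where W: "open W" "0 \<in> W" and c: "continuous_on W \<sigma>"
      and inv: "\<And>y. y \<in> W \<Longrightarrow> invertible (M (\<sigma> y))"
      and d: "\<And>y. y \<in> W \<Longrightarrow> (\<sigma> has_derivative (*v) (matrix_inv (M (\<sigma> y)) ** P)) (at y)"
      using lip_localization_has_derivative[OF localized lip_inv[OF lip] lip] by metis
    show ?thesis
    proof (intro exI[of _ W] conjI allI impI ballI W)
      show "\<exists>D. (\<forall>y\<in>W. (\<sigma> has_derivative (\<lambda>v. D y *v v)) (at y)) \<and> continuous_on W D"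
        \<comment> \<open>This form of the derivative is independent of \<open>B\<close>, so
          smoothness follows whether or not the type \<open>'s\<close> has \<open>dim Kbar\<close>
          elements.\<close>
        by (intro exI[of _ "\<lambda>y. matrix_inv (M (\<sigma> y)) ** P"] conjI ballI d
            continuous_on_matrix_matrix_mult continuous_on_matrix_inv inv
            continuous_on_compose2[OF contM c] continuous_on_const) auto
    next
      \<comment> \<open>An index type has at least one element, so no \<open>B\<close> can represent
        the empty basis; here \<open>P\<close> is zero and the derivative vanishes.\<close>
      fix y assume K0: "Kbar = {0}" and y: "y \<in> W"
      have "P *v v = 0" for v using P(1) K0 by blast
      then have "(*v) (matrix_inv (M (\<sigma> y)) ** P) = (\<lambda>v. 0)"
        by (simp add: fun_eq_iff flip: matrix_vector_mul_assoc)
      then show "(\<sigma> has_derivative (\<lambda>v. 0)) (at y)" using d[OF y] by simp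
    next
      fix B :: "real^'s^'m" and y
      assume B: "columns B \<subseteq> Kbar \<and> span (columns B) = Kbar \<and> CARD('s) = dim Kbar" and y: "y \<in> W"
      then show "(\<sigma> has_derivative
          (\<lambda>v. (B ** matrix_inv (transpose B ** J (\<sigma> y) ** B) ** transpose B) *v v)) (at y)"
        using d[OF y] matrix_inv_reduced_matrix_basis[OF proj inv[OF y, unfolded M_def], of B]
        unfolding M_def by metis
    qed
  qed
  then show ?thesis
    using a_iff b_iff lip_inv exists_lip_localization[OF localized] by blast
qed

end
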